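(* The SubCubeSums proof system $p$-simulates MaxResW. Quantitatively: there is a polynomial-time procedure and an absolute constant $K$ such that, for every unsatisfiable CNF formula $F$ with $n$ variables and $m$ clauses, the procedure converts any MaxResW refutation of $F$ of size $s$ into a SubCubeSums proof for $F$ whose combinatorial size and whose algebraic size are both at most $K(m+ns)$.
   Context: Clauses are disjunctions of sets of literals with no complementary pair $x,\overline{x}$. For a multi-set $F$ of clauses over variables $X$ and a total assignment $\alpha\in\{0,1\}^X$, $\mathrm{viol}_F(\alpha)$ is the number of clauses of $F$ (with multiplicity) falsified by $\alpha$. MaxSAT resolution rule: from $x\vee A$ and $\overline{x}\vee B$ with $A=a_1\vee\dots\vee a_s$, $B=b_1\vee\dots\vee b_t$, derive $A\vee B$; the clauses $x\vee A\vee b_1\vee\dots\vee b_{j-1}\vee\overline{b_j}$ for $1\le j\le t$; and the clauses $\overline{x}\vee B\vee a_1\vee\dots\vee a_{j-1}\vee\overline{a_j}$ for $1\le j\le s$. Weakening rule: replace a clause $A$ by the two clauses $A\vee x$ and $A\vee\overline{x}$. When a rule is applied to a multi-set of clauses, (one copy of) each antecedent is removed and all non-tautologous consequents are added. A MaxResW refutation of $F$ is a sequence of multi-sets $F=F_0,F_1,\dots,F_s$, each obtained from the previous one by one application of the MaxSAT resolution rule or the weakening rule, with $F_s$ containing the empty clause; its size is $s$. A SubCubeSums proof for an unsatisfiable CNF $F$ over $X$ is a multi-set $G$ of clauses over $X$ with $\mathrm{viol}_F(\alpha)=1+\mathrm{viol}_G(\alpha)$ for all $\alpha\in\{0,1\}^X$.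 Its combinatorial size is the number of clauses of $G$ counted with multiplicity. Algebraic size: use $2n$ formal variables $x_j,\overline{x_j}$ ($j\in[n]$). Encode the literal $x_j$ by $e(x_j)=\overline{x_j}$, the literal $\neg x_j$ by $e(\neg x_j)=x_j$, and a clause by the product of the encodings of its literals. A Sherali--Adams representation of the SubCubeSums proof $G$ for $F$ is a choice of polynomials $r_j$ with integer coefficients such that, as a polynomial identity in the $2n$ variables, $$-\sum_{C\in F}e(C)+\sum_{j\in[n]}r_j(1-x_j-\overline{x_j})+\sum_{C\in G}e(C)+1=0 .$$ Its size is $|F|+|G|+\sum_j\|r_j(1-x_j-\overline{x_j})\|_1$, where $\|\cdot\|_1$ is the sum of absolute values of the coefficients of the expanded polynomial. The algebraic size of $G$ is the minimum size of such a representation. *)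

theory Defs
  imports
    Main
    "HOL-Library.Multiset"
    "HOL-Library.Poly_Mapping"
    "HOL-Library.Extended_Nat"
    "HOL-Computational_Algebra.Polynomial"
begin

section \<open>Clauses and multi-sets of clauses\<close>

datatype lit = Pos nat | Neg nat

fun neg :: "lit \<Rightarrow> lit" where
  "neg (Pos j) = Neg j"
| "neg (Neg j) = Pos j"

type_synonym clause = "lit set"
type_synonym formula = "clause multiset"

text \<open>The variable set is \<open>X = {1..n}\<close>.\<close>

definition lits :: "nat \<Rightarrow> lit set" where
  "lits n = Pos ` {1..n} \<union> Neg ` {1..n}"

definition tautologous :: "lit set \<Rightarrow> bool" where
  "tautologous C \<longleftrightarrow> (\<exists>l\<in>C. neg l \<in> C)"

definition cnf :: "nat \<Rightarrow> formula \<Rightarrow> bool" where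
  "cnf n F \<longleftrightarrow> (\<forall>C\<in>#F. C \<subseteq> lits n \<and> \<not> tautologous C)"

fun lit_true :: "(nat \<Rightarrow> bool) \<Rightarrow> lit \<Rightarrow> bool" where
  "lit_true \<alpha> (Pos j) = \<alpha> j"
| "lit_true \<alpha> (Neg j) = (\<not> \<alpha> j)"

text \<open>Assignments are total functions on \<^typ>\<open>nat\<close>; for \<open>cnf n F\<close> only their values
  on \<open>{1..n}\<close> matter.\<close>

definition falsifies :: "(nat \<Rightarrow> bool) \<Rightarrow> clause \<Rightarrow> bool" where
  "falsifies \<alpha> C \<longleftrightarrow> (\<forall>l\<in>C. \<not> lit_true \<alpha> l)"

definition viol :: "formula \<Rightarrow> (nat \<Rightarrow> bool) \<Rightarrow> nat" where
  "viol F \<alpha> = size {#C \<in># F. falsifies \<alpha> C#}"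

definition unsatisfiable :: "formula \<Rightarrow> bool" where
  "unsatisfiable F \<longleftrightarrow> (\<forall>\<alpha>. \<exists>C\<in>#F. falsifies \<alpha> C)"


section \<open>MaxSAT resolution with weakening\<close>

text \<open>The consequents of the MaxSAT resolution rule depend on the order in which the literals
  of the side clauses are listed, hence the lists; any order may be used.\<close>

definition side_consequents :: "lit \<Rightarrow> lit list \<Rightarrow> lit list \<Rightarrow> formula" where
  "side_consequents l as bs =
     mset (map (\<lambda>j. insert l (set as) \<union> set (take j bs) \<union> {neg (bs ! j)}) [0..<length bs])"

definition resolution_consequents :: "nat \<Rightarrow> lit list \<Rightarrow> lit list \<Rightarrow> formula" where
  "resolution_consequents x as bs =
     {# set as \<union> set bs #} + side_consequents (Pos x) as bs + side_consequents (Neg x) bs as"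

definition non_tautologous :: "lit set multiset \<Rightarrow> formula" where
  "non_tautologous F = {#C \<in># F. \<not> tautologous C#}"

inductive maxresw_step :: "formula \<Rightarrow> formula \<Rightarrow> bool" where
  resolution:
    "\<lbrakk> distinct as; distinct bs; Pos x \<notin> set as; Neg x \<notin> set bs \<rbrakk> \<Longrightarrow>
     maxresw_step
       (H + {# insert (Pos x) (set as), insert (Neg x) (set bs) #})
       (H + non_tautologous (resolution_consequents x as bs))"
| weakening:
    "maxresw_step
       (H + {# A #})
       (H + non_tautologous {# insert (Pos x) A, insert (Neg x) A #})"

text \<open>A refutation is the list \<open>[F\<^sub>0, \<dots>, F\<^sub>s]\<close>; its size is the number \<open>s\<close> of steps.\<close>

definition maxresw_refutation :: "nat \<Rightarrow> formula \<Rightarrow> formula list \<Rightarrow> bool" where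
  "maxresw_refutation n F \<pi> \<longleftrightarrow>
     \<pi> \<noteq> [] \<and> hd \<pi> = F \<and> (\<forall>H\<in>set \<pi>. cnf n H) \<and>
     (\<forall>i. Suc i < length \<pi> \<longrightarrow> maxresw_step (\<pi> ! i) (\<pi> ! Suc i)) \<and>
     {} \<in># last \<pi>"

definition refutation_size :: "formula list \<Rightarrow> nat" where
  "refutation_size \<pi> = length \<pi> - 1"


section \<open>SubCubeSums\<close>

definition subcubesums_proof :: "nat \<Rightarrow> formula \<Rightarrow> formula \<Rightarrow> bool" where
  "subcubesums_proof n F G \<longleftrightarrow>
     cnf n F \<and> cnf n G \<and> (\<forall>\<alpha>. viol F \<alpha> = 1 + viol G \<alpha>)"

definition combinatorial_size :: "formula \<Rightarrow> nat" where
  "combinatorial_size G = size G"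

text \<open>Integer polynomials whose formal variables are indexed by literals:
  \<open>var (Pos j)\<close> is \<open>x\<^sub>j\<close>, and \<open>var (Neg j)\<close> is the formal variable written \<open>x\<^sub>j\<close> with a bar.
  A polynomial maps monomials to coefficients, and a monomial maps variables to exponents.\<close>

type_synonym int_poly = "(lit \<Rightarrow>\<^sub>0 nat) \<Rightarrow>\<^sub>0 int"

definition var :: "lit \<Rightarrow> int_poly" where
  "var l = Poly_Mapping.single (Poly_Mapping.single l 1) 1"

definition polys_over :: "nat \<Rightarrow> int_poly set" where
  "polys_over n = {p. \<forall>m\<in>Poly_Mapping.keys p. Poly_Mapping.keys m \<subseteq> lits n}"

definition l1_norm :: "int_poly \<Rightarrow> nat" where
  "l1_norm p = (\<Sum>m\<in>Poly_Mapping.keys p. nat \<bar>Poly_Mapping.lookup p m\<bar>)"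

text \<open>The encoding of a literal is the formal variable of the complementary literal, so that it
  takes the value 1 exactly when the literal is falsified.\<close>

definition encode_clause :: "clause \<Rightarrow> int_poly" where
  "encode_clause C = (\<Prod>l\<in>C. var (neg l))"

definition sa_representation :: "nat \<Rightarrow> formula \<Rightarrow> formula \<Rightarrow> (nat \<Rightarrow> int_poly) \<Rightarrow> bool" where
  "sa_representation n F G r \<longleftrightarrow>
     (\<forall>j\<in>{1..n}. r j \<in> polys_over n) \<and>
     - (\<Sum>C\<in>#F. encode_clause C)
       + (\<Sum>j\<in>{1..n}. r j * (1 - var (Pos j) - var (Neg j)))
       + (\<Sum>C\<in>#G. encode_clause C) + 1 = 0"

definition sa_size :: "nat \<Rightarrow> formula \<Rightarrow> formula \<Rightarrow> (nat \<Rightarrow> int_poly) \<Rightarrow> nat" where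
  "sa_size n F G r =
     size F + size G + (\<Sum>j\<in>{1..n}. l1_norm (r j * (1 - var (Pos j) - var (Neg j))))"

text \<open>The infimum over \<^typ>\<open>enat\<close> is attained whenever a representation exists, and is
  \<open>\<infinity>\<close> otherwise.\<close>

definition algebraic_size :: "nat \<Rightarrow> formula \<Rightarrow> formula \<Rightarrow> enat" where
  "algebraic_size n F G = (INF r\<in>{r. sa_representation n F G r}. enat (sa_size n F G r))"


section \<open>Polynomial-time computation\<close>

text \<open>Deterministic single-tape Turing machines. The states are \<open>0, \<dots>, Q\<close> with start state \<open>0\<close>
  and halting state \<open>Q = num_states M\<close>; the tape symbols are \<open>0, \<dots>, num_symbols M - 1\<close>, where
  \<open>0\<close> is the blank.\<close>

type_synonym word = "nat list"

datatype move = MoveLeft | Stay | MoveRight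

record tm =
  num_states :: nat
  num_symbols :: nat
  delta :: "nat \<Rightarrow> nat \<Rightarrow> nat \<times> nat \<times> move"

definition wf_tm :: "tm \<Rightarrow> bool" where
  "wf_tm M \<longleftrightarrow>
     (\<forall>q<num_states M. \<forall>a<num_symbols M. case delta M q a of (q', b, _) \<Rightarrow>
        q' \<le> num_states M \<and> b < num_symbols M)"

text \<open>In \<open>(q, ls, rs)\<close> the head scans the first cell of \<open>rs\<close>; \<open>ls\<close> lists the cells to the left
  of the head, nearest first. All cells beyond the two lists are blank.\<close>

type_synonym config = "nat \<times> word \<times> word"

fun scanned :: "word \<Rightarrow> nat" where
  "scanned [] = 0"
| "scanned (a # _) = a"

fun shift_head :: "move \<Rightarrow> word \<Rightarrow> word \<Rightarrow> word \<times> word" where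
  "shift_head MoveLeft ls rs = (tl ls, scanned ls # rs)"
| "shift_head Stay ls rs = (ls, rs)"
| "shift_head MoveRight ls rs = (scanned rs # ls, tl rs)"

fun tm_step :: "tm \<Rightarrow> config \<Rightarrow> config" where
  "tm_step M (q, ls, rs) =
     (if q = num_states M then (q, ls, rs)
      else case delta M q (scanned rs) of (q', b, d) \<Rightarrow> (q', shift_head d ls (b # tl rs)))"

text \<open>The output is the blank-free word that starts at the final head position.\<close>

definition tm_outputs :: "tm \<Rightarrow> word \<Rightarrow> nat \<Rightarrow> word \<Rightarrow> bool" where
  "tm_outputs M w t v \<longleftrightarrow>
     (\<exists>ls rs. (tm_step M ^^ t) (0, [], w) = (num_states M, ls, rs) \<and>
              v = takeWhile (\<lambda>a. a \<noteq> 0) rs)"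

definition poly_time :: "nat \<Rightarrow> (word \<Rightarrow> word) \<Rightarrow> bool" where
  "poly_time k f \<longleftrightarrow>
     (\<exists>M (p :: nat poly). wf_tm M \<and> k < num_symbols M \<and>
        (\<forall>w. set w \<subseteq> {1..k} \<longrightarrow> (\<exists>t \<le> poly p (length w). tm_outputs M w t (f w))))"


section \<open>Words for formulas and refutations\<close>

text \<open>Alphabet: the bits 0 and 1 are the symbols 1 and 2; the symbols 3 and 4 start a positive and
  a negative literal; 5 starts a clause; 6 starts a multi-set of clauses. Variable indices are in
  binary, least significant bit first. Sets and multi-sets may be listed in any order.\<close>

abbreviation alphabet_size :: nat where
  "alphabet_size \<equiv> 6"

fun bits :: "nat \<Rightarrow> word" where
  "bits j = (if j = 0 then [] else (if odd j then 2 else 1) # bits (j div 2))"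

declare bits.simps [simp del]

fun lit_word :: "lit \<Rightarrow> word" where
  "lit_word (Pos j) = 3 # bits j"
| "lit_word (Neg j) = 4 # bits j"

definition clause_word :: "clause \<Rightarrow> word \<Rightarrow> bool" where
  "clause_word C w \<longleftrightarrow>
     (\<exists>ls. distinct ls \<and> set ls = C \<and> w = 5 # concat (map lit_word ls))"

definition formula_word :: "formula \<Rightarrow> word \<Rightarrow> bool" where
  "formula_word F w \<longleftrightarrow>
     (\<exists>Cs ws. mset Cs = F \<and> list_all2 clause_word Cs ws \<and> w = 6 # concat ws)"

definition sequence_word :: "formula list \<Rightarrow> word \<Rightarrow> bool" where
  "sequence_word \<pi> w \<longleftrightarrow> (\<exists>ws. list_all2 formula_word \<pi> ws \<and> w = concat ws)"


section \<open>Simulation between proof systems\<close>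

text \<open>A proof system is given by the relation \<open>P n F w\<close>: the word \<open>w\<close> is a proof for the formula
  \<open>F\<close> over the variables \<open>{1..n}\<close>.\<close>

type_synonym proof_system = "nat \<Rightarrow> formula \<Rightarrow> word \<Rightarrow> bool"

definition MaxResW :: proof_system where
  "MaxResW n F w \<longleftrightarrow> (\<exists>\<pi>. maxresw_refutation n F \<pi> \<and> sequence_word \<pi> w)"

definition SubCubeSums :: proof_system where
  "SubCubeSums n F w \<longleftrightarrow> (\<exists>G. subcubesums_proof n F G \<and> formula_word G w)"

definition p_simulation :: "(word \<Rightarrow> word) \<Rightarrow> proof_system \<Rightarrow> proof_system \<Rightarrow> bool" where
  "p_simulation f Q P \<longleftrightarrow>
     poly_time alphabet_size f \<and>
     (\<forall>n F w. cnf n F \<and> unsatisfiable F \<and> P n F w \<longrightarrow> Q n F (f w))"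

end

theory Submission
  imports Defs
begin

text \<open>A refutation is turned into its last multi-set with one copy of the empty clause removed.
  Both rules are compositions of splittings of a clause \<open>C\<close> into \<open>C \<or> l\<close> and \<open>C \<or> \<not>l\<close> (or the
  inverse), at most \<open>2 * n\<close> of them per step, and a splitting either changes nothing (when \<open>l\<close> or
  \<open>\<not>l\<close> is in \<open>C\<close> and the tautologous half is dropped) or costs the single polynomial
  \<open>e(C) * (1 - x - x')\<close> with three monomials. On words, a Turing machine looks for the last
  multi-set and closes the gap left by an empty clause in it by shifting its beginning to the
  right.\<close>

section \<open>Clauses and polynomials\<close>

lemma neg_neg [simp]: "neg (neg l) = l"
  by (cases l) auto

lemma neg_neq [simp]: "neg l \<noteq> l" "l \<noteq> neg l"
  by (cases l; auto)+

lemma neg_in_lits [simp]: "neg l \<in> lits n \<longleftrightarrow> l \<in> lits n"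
  by (cases l) (auto simp: lits_def)

lemma Pos_in_lits [simp]: "Pos x \<in> lits n \<longleftrightarrow> x \<in> {1..n}"
  and Neg_in_lits [simp]: "Neg x \<in> lits n \<longleftrightarrow> x \<in> {1..n}"
  by (auto simp: lits_def)

lemma finite_lits [simp]: "finite (lits n)"
  by (simp add: lits_def)

lemma lit_true_neg [simp]: "lit_true \<alpha> (neg l) \<longleftrightarrow> \<not> lit_true \<alpha> l"
  by (cases l) auto

lemma tautologous_insert:
  "tautologous (insert l C) \<longleftrightarrow> neg l \<in> C \<or> tautologous C"
  by (auto simp: tautologous_def)

text \<open>Forgetting signs is injective on a clause without complementary literals. This width
  bound is the source of the factor \<open>n\<close> in the cost of a step.\<close>

lemma card_clause_le:
  assumes "C \<subseteq> lits n" "\<not> tautologous C"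
  shows "card C \<le> n"
proof -
  define v where "v = (\<lambda>l. case l of Pos j \<Rightarrow> j | Neg j \<Rightarrow> j)"
  have v: "v l = v l' \<longleftrightarrow> l = l' \<or> l = neg l'" for l l'
    by (cases l; cases l') (auto simp: v_def)
  have "inj_on v C"
    using assms(2) unfolding inj_on_def v tautologous_def by blast
  moreover have "v ` C \<subseteq> {1..n}"
    using assms(1) by (force simp: v_def lits_def)
  ultimately show ?thesis
    using card_inj_on_le[of v C "{1..n}"] by simp
qed

lemma viol_add [simp]: "viol (F + G) \<alpha> = viol F \<alpha> + viol G \<alpha>"
  by (simp add: viol_def)

lemma viol_add_mset [simp]:
  "viol (add_mset C F) \<alpha> = (if falsifies \<alpha> C then 1 else 0) + viol F \<alpha>"
  by (simp add: viol_def)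

lemma non_tautologous_add [simp]:
  "non_tautologous (F + G) = non_tautologous F + non_tautologous G"
  by (simp add: non_tautologous_def)

lemma non_tautologous_empty [simp]: "non_tautologous {#} = {#}"
  by (simp add: non_tautologous_def)

lemma non_tautologous_add_mset:
  "non_tautologous (add_mset C F) =
     (if tautologous C then non_tautologous F else add_mset C (non_tautologous F))"
  by (simp add: non_tautologous_def)

lemma size_non_tautologous_le: "size (non_tautologous F) \<le> size F"
  by (simp add: non_tautologous_def)

section \<open>Norms of polynomials and clauses as monomials\<close>

lemma l1_norm_superset:
  assumes "finite A" "Poly_Mapping.keys p \<subseteq> A"
  shows "l1_norm p = (\<Sum>m\<in>A. nat \<bar>Poly_Mapping.lookup p m\<bar>)"
  unfolding l1_norm_def using assms
  by (intro sum.mono_neutral_left) (auto simp: in_keys_iff)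

lemma l1_norm_add_le: "l1_norm (p + q) \<le> l1_norm p + l1_norm q"
proof -
  let ?A = "Poly_Mapping.keys p \<union> Poly_Mapping.keys q"
  have "l1_norm (p + q) = (\<Sum>m\<in>?A. nat \<bar>Poly_Mapping.lookup (p + q) m\<bar>)"
    using keys_add[of p q] by (intro l1_norm_superset) auto
  also have "\<dots> \<le> (\<Sum>m\<in>?A. nat \<bar>Poly_Mapping.lookup p m\<bar> + nat \<bar>Poly_Mapping.lookup q m\<bar>)"
    by (rule sum_mono) (simp add: lookup_add)
  also have "\<dots> = l1_norm p + l1_norm q"
    by (simp add: sum.distrib l1_norm_superset[of ?A])
  finally show ?thesis .
qed

lemma l1_norm_uminus [simp]: "l1_norm (- p) = l1_norm p"
  by (simp add: l1_norm_def)

lemma l1_norm_diff_le: "l1_norm (p - q) \<le> l1_norm p + l1_norm q"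
  using l1_norm_add_le[of p "- q"] by simp

lemma l1_norm_zero [simp]: "l1_norm 0 = 0"
  by (simp add: l1_norm_def)

lemma l1_norm_single [simp]: "l1_norm (Poly_Mapping.single m c) = nat \<bar>c\<bar>"
  by (simp add: l1_norm_def)

lemma polys_over_zero [simp]: "0 \<in> polys_over n"
  by (simp add: polys_over_def)

lemma polys_over_add: "p \<in> polys_over n \<Longrightarrow> q \<in> polys_over n \<Longrightarrow> p + q \<in> polys_over n"
  unfolding polys_over_def using keys_add[of p q] by blast

lemma polys_over_uminus: "p \<in> polys_over n \<Longrightarrow> - p \<in> polys_over n"
  by (simp add: polys_over_def)

text \<open>Each clause becomes one monomial with coefficient 1, so norms of its multiples can be
  read off.\<close>

lemma encode_clause_eq_single:
  assumes "finite C"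
  shows "encode_clause C = Poly_Mapping.single (\<Sum>l\<in>C. Poly_Mapping.single (neg l) 1) 1"
  unfolding encode_clause_def using assms
  by (induction C rule: finite_induct) (simp_all add: var_def mult_single)

lemma encode_clause_in_polys_over:
  assumes "C \<subseteq> lits n"
  shows "encode_clause C \<in> polys_over n"
proof -
  have fin: "finite C" using assms finite_lits by (rule finite_subset)
  have "Poly_Mapping.keys (\<Sum>l\<in>C. Poly_Mapping.single (neg l) (1::nat))
      \<subseteq> (\<Union>l\<in>C. Poly_Mapping.keys (Poly_Mapping.single (neg l) (1::nat)))"
    by (rule keys_sum)
  also have "\<dots> \<subseteq> lits n" using assms by auto
  finally show ?thesis by (simp add: encode_clause_eq_single fin polys_over_def)
qed

lemma encode_clause_empty [simp]: "encode_clause {} = 1"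
  by (simp add: encode_clause_def)

lemma encode_clause_insert:
  "finite C \<Longrightarrow> l \<notin> C \<Longrightarrow> encode_clause (insert l C) = encode_clause C * var (neg l)"
  by (simp add: encode_clause_def mult.commute)

abbreviation axiom_poly :: "nat \<Rightarrow> int_poly" where
  "axiom_poly j \<equiv> 1 - var (Pos j) - var (Neg j)"

lemma l1_norm_encode_mult_axiom_le:
  assumes "finite C"
  shows "l1_norm (encode_clause C * axiom_poly j) \<le> 3"
proof -
  let ?m = "\<Sum>l\<in>C. Poly_Mapping.single (neg l) (1::nat)"
  have "encode_clause C * axiom_poly j =
      Poly_Mapping.single ?m 1
      - Poly_Mapping.single (?m + Poly_Mapping.single (Pos j) 1) 1
      - Poly_Mapping.single (?m + Poly_Mapping.single (Neg j) 1) 1"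
    by (simp add: encode_clause_eq_single assms var_def right_diff_distrib mult_single)
  also have "l1_norm \<dots> \<le> l1_norm (Poly_Mapping.single ?m (1::int))
      + l1_norm (Poly_Mapping.single (?m + Poly_Mapping.single (Pos j) 1) (1::int))
      + l1_norm (Poly_Mapping.single (?m + Poly_Mapping.single (Neg j) 1) (1::int))"
    by (meson add_right_mono l1_norm_diff_le le_trans)
  also have "\<dots> = 3" by simp
  finally show ?thesis .
qed

section \<open>Equivalence of multi-sets of clauses with bounded cost\<close>

text \<open>The semantic condition and a Sherali-Adams certificate are carried together;
  \<open>k\<close> bounds the same expanded norms that \<open>sa_size\<close> counts. Only
  differences of \<open>F\<close> and \<open>G\<close> enter, so the relation is symmetric, additive
  and cancellative.\<close>

definition sa_equiv :: "nat \<Rightarrow> nat \<Rightarrow> formula \<Rightarrow> formula \<Rightarrow> bool" where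
  "sa_equiv n k F G \<longleftrightarrow>
     (\<forall>\<alpha>. viol F \<alpha> = viol G \<alpha>) \<and>
     (\<exists>r. (\<forall>j\<in>{1..n}. r j \<in> polys_over n) \<and>
        (\<Sum>C\<in>#F. encode_clause C) - (\<Sum>C\<in>#G. encode_clause C) = (\<Sum>j\<in>{1..n}. r j * axiom_poly j) \<and>
        (\<Sum>j\<in>{1..n}. l1_norm (r j * axiom_poly j)) \<le> k)"

lemma sa_equiv_refl: "sa_equiv n k F F"
  unfolding sa_equiv_def by (auto intro!: exI[of _ "\<lambda>_. 0"])

lemma sa_equiv_mono: "sa_equiv n k F G \<Longrightarrow> k \<le> k' \<Longrightarrow> sa_equiv n k' F G"
  unfolding sa_equiv_def by (meson le_trans)

text \<open>Negating every \<open>r j\<close> keeps all norms. This allows a splitting to be read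
  backwards as a merge.\<close>

lemma sa_equiv_sym:
  assumes "sa_equiv n k F G"
  shows "sa_equiv n k G F"
proof -
  from assms obtain r where r: "\<forall>j\<in>{1..n}. r j \<in> polys_over n"
    "(\<Sum>C\<in>#F. encode_clause C) - (\<Sum>C\<in>#G. encode_clause C) = (\<Sum>j\<in>{1..n}. r j * axiom_poly j)"
    "(\<Sum>j\<in>{1..n}. l1_norm (r j * axiom_poly j)) \<le> k"
    unfolding sa_equiv_def by blast
  have "(\<Sum>C\<in>#G. encode_clause C) - (\<Sum>C\<in>#F. encode_clause C) = - (\<Sum>j\<in>{1..n}. r j * axiom_poly j)"
    using r(2) by (metis minus_diff_eq)
  also have "\<dots> = (\<Sum>j\<in>{1..n}. (- r j) * axiom_poly j)"
    by (simp add: sum_negf)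
  finally have "(\<Sum>C\<in>#G. encode_clause C) - (\<Sum>C\<in>#F. encode_clause C) = (\<Sum>j\<in>{1..n}. (- r j) * axiom_poly j)" .
  moreover have "(\<Sum>j\<in>{1..n}. l1_norm ((- r j) * axiom_poly j)) \<le> k"
    using r(3) by (simp only: mult_minus_left l1_norm_uminus)
  moreover have "\<forall>j\<in>{1..n}. - r j \<in> polys_over n"
    using r(1) polys_over_uminus by blast
  moreover have "\<forall>\<alpha>. viol G \<alpha> = viol F \<alpha>"
    using assms by (simp add: sa_equiv_def)
  ultimately show ?thesis
    unfolding sa_equiv_def by (intro conjI exI[of _ "\<lambda>j. - r j"])
qed

lemma sa_equiv_add:
  assumes "sa_equiv n k F G" "sa_equiv n k' F' G'"
  shows "sa_equiv n (k + k') (F + F') (G + G')"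
proof -
  from assms(1) obtain r where r: "\<forall>j\<in>{1..n}. r j \<in> polys_over n"
    "(\<Sum>C\<in>#F. encode_clause C) - (\<Sum>C\<in>#G. encode_clause C) = (\<Sum>j\<in>{1..n}. r j * axiom_poly j)"
    "(\<Sum>j\<in>{1..n}. l1_norm (r j * axiom_poly j)) \<le> k"
    unfolding sa_equiv_def by blast
  from assms(2) obtain r' where r': "\<forall>j\<in>{1..n}. r' j \<in> polys_over n"
    "(\<Sum>C\<in>#F'. encode_clause C) - (\<Sum>C\<in>#G'. encode_clause C) = (\<Sum>j\<in>{1..n}. r' j * axiom_poly j)"
    "(\<Sum>j\<in>{1..n}. l1_norm (r' j * axiom_poly j)) \<le> k'"
    unfolding sa_equiv_def by blast
  have "(\<Sum>C\<in>#F + F'. encode_clause C) - (\<Sum>C\<in>#G + G'. encode_clause C)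
      = (\<Sum>j\<in>{1..n}. r j * axiom_poly j) + (\<Sum>j\<in>{1..n}. r' j * axiom_poly j)"
    unfolding r(2)[symmetric] r'(2)[symmetric] by simp
  also have "\<dots> = (\<Sum>j\<in>{1..n}. (r j + r' j) * axiom_poly j)"
    by (simp only: distrib_right sum.distrib)
  finally have eq: "(\<Sum>C\<in>#F + F'. encode_clause C) - (\<Sum>C\<in>#G + G'. encode_clause C)
      = (\<Sum>j\<in>{1..n}. (r j + r' j) * axiom_poly j)" .
  have "(\<Sum>j\<in>{1..n}. l1_norm ((r j + r' j) * axiom_poly j))
      \<le> (\<Sum>j\<in>{1..n}. l1_norm (r j * axiom_poly j) + l1_norm (r' j * axiom_poly j))"
    unfolding distrib_right by (intro sum_mono l1_norm_add_le)
  also have "\<dots> \<le> k + k'"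
    using r(3) r'(3) by (simp only: sum.distrib add_mono)
  finally show ?thesis
    unfolding sa_equiv_def using assms[unfolded sa_equiv_def] r(1) r'(1) eq
    by (intro conjI exI[of _ "\<lambda>j. r j + r' j"]) (auto intro: polys_over_add)
qed

lemma sa_equiv_cancel:
  assumes "sa_equiv n k (F + H) (G + H)"
  shows "sa_equiv n k F G"
  using assms unfolding sa_equiv_def by simp

text \<open>Adding the two equivalences puts \<open>G\<close> on both sides, where it
  cancels.\<close>

lemma sa_equiv_trans:
  assumes "sa_equiv n k F G" "sa_equiv n k' G H"
  shows "sa_equiv n (k + k') F H"
  using sa_equiv_add[OF assms] by (intro sa_equiv_cancel[of n _ F G H]) (simp add: add.commute)

text \<open>Filtering both sides by \<open>non_tautologous\<close> also covers the degenerate cases: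
  if \<open>l\<close> or \<open>neg l\<close> is in \<open>C\<close>, one half is \<open>C\<close>
  itself and the other is tautologous.\<close>

lemma sa_equiv_split:
  assumes "C \<subseteq> lits n" "l \<in> lits n"
  shows "sa_equiv n 3 (non_tautologous {#C#}) (non_tautologous {#insert l C, insert (neg l) C#})"
proof (cases "tautologous C \<or> l \<in> C \<or> neg l \<in> C")
  case True
  then have "non_tautologous {#C#} = non_tautologous {#insert l C, insert (neg l) C#}"
    by (cases "tautologous C")
      (auto simp: non_tautologous_add_mset tautologous_insert insert_absorb tautologous_def[of C])
  then show ?thesis by (simp add: sa_equiv_refl)
next
  case False
  obtain i where i: "i \<in> {1..n}" "l = Pos i \<or> l = Neg i"
    using assms(2) by (cases l) auto
  have fin: "finite C" using assms(1) finite_lits by (rule finite_subset)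
  define r where "r = (\<lambda>j. if j = i then encode_clause C else 0)"
  have l1: "l1_norm (r j * axiom_poly j) = (if j = i then l1_norm (encode_clause C * axiom_poly i) else 0)" for j
    by (simp add: r_def)
  have r: "r j * axiom_poly j = (if j = i then encode_clause C * axiom_poly i else 0)" for j
    by (simp add: r_def)
  have *: "non_tautologous {#C#} = {#C#}"
    "non_tautologous {#insert l C, insert (neg l) C#} = {#insert l C, insert (neg l) C#}"
    using False by (auto simp: non_tautologous_add_mset tautologous_insert)
  have "encode_clause C - (encode_clause (insert l C) + encode_clause (insert (neg l) C))
      = encode_clause C * axiom_poly i"
    using False i fin by (auto simp: encode_clause_insert algebra_simps)
  then have "(\<Sum>C\<in>#{#C#}. encode_clause C) - (\<Sum>C\<in>#{#insert l C, insert (neg l) C#}. encode_clause C)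
      = (\<Sum>j\<in>{1..n}. r j * axiom_poly j)"
    unfolding r using i by simp
  moreover have "(\<Sum>j\<in>{1..n}. l1_norm (r j * axiom_poly j)) \<le> 3"
    unfolding l1 using i l1_norm_encode_mult_axiom_le[OF fin] by simp
  moreover have "\<forall>j\<in>{1..n}. r j \<in> polys_over n"
    using encode_clause_in_polys_over[OF assms(1)] by (simp add: r_def)
  \<comment> \<open>An assignment falsifying \<open>C\<close> falsifies exactly one of
    \<open>l\<close> and \<open>neg l\<close>.\<close>
  moreover have "viol {#C#} \<alpha> = viol {#insert l C, insert (neg l) C#} \<alpha>" for \<alpha>
    by (auto simp: falsifies_def)
  ultimately show ?thesis
    unfolding * sa_equiv_def by blast
qed

text \<open>Split on the literals of \<open>bs\<close> in turn: the half with the negated literal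
  stays, the other half is split further. The last splitting concerns the last literal, hence
  induction from the right.\<close>

lemma sa_equiv_split_chain:
  assumes "C \<subseteq> lits n" "set bs \<subseteq> lits n"
  shows "sa_equiv n (3 * length bs) (non_tautologous {#C#})
    (non_tautologous ({#C \<union> set bs#} +
       mset (map (\<lambda>j. C \<union> set (take j bs) \<union> {neg (bs ! j)}) [0..<length bs])))"
  using assms(2)
proof (induction bs rule: rev_induct)
  case Nil
  then show ?case by (simp add: sa_equiv_refl)
next
  case (snoc b bs)
  let ?S = "\<lambda>bs. mset (map (\<lambda>j. C \<union> set (take j bs) \<union> {neg (bs ! j)}) [0..<length bs])"
  \<comment> \<open>For \<open>j < length bs\<close> neither \<open>take j\<close> nor
    \<open>! j\<close> sees the appended \<open>b\<close>.\<close>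
  have S: "?S (bs @ [b]) = {#insert (neg b) (C \<union> set bs)#} + ?S bs"
    by (auto simp: nth_append intro!: image_mset_cong)
  have "sa_equiv n 3 (non_tautologous {#C \<union> set bs#})
      (non_tautologous {#insert b (C \<union> set bs), insert (neg b) (C \<union> set bs)#})"
    using snoc.prems assms(1) by (intro sa_equiv_split) auto
  from sa_equiv_add[OF this sa_equiv_refl[of n 0 "non_tautologous (?S bs)"]]
  have "sa_equiv n 3 (non_tautologous ({#C \<union> set bs#} + ?S bs))
      (non_tautologous ({#insert b (C \<union> set bs), insert (neg b) (C \<union> set bs)#} + ?S bs))"
    by (simp only: non_tautologous_add add_0_right)
  also have "{#insert b (C \<union> set bs), insert (neg b) (C \<union> set bs)#} + ?S bs
      = {#C \<union> set (bs @ [b])#} + ?S (bs @ [b])"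
    unfolding S by simp
  finally have "sa_equiv n 3 (non_tautologous ({#C \<union> set bs#} + ?S bs))
      (non_tautologous ({#C \<union> set (bs @ [b])#} + ?S (bs @ [b])))" .
  from sa_equiv_trans[OF snoc.IH this] snoc.prems show ?case
    by (simp add: add.commute)
qed

text \<open>Splitting the first antecedent along \<open>bs\<close> and the second along
  \<open>as\<close> yields all side consequents and two clauses that differ only in the sign of
  \<open>x\<close>. One splitting on \<open>x\<close>, read backwards, merges these into the
  resolvent.\<close>

lemma sa_equiv_resolution:
  assumes "\<not> tautologous (insert (Pos x) (set as))" "\<not> tautologous (insert (Neg x) (set bs))"
    and "insert (Pos x) (set as) \<subseteq> lits n" "insert (Neg x) (set bs) \<subseteq> lits n"
  shows "sa_equiv n (3 * length bs + 3 * length as + 3)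
    {#insert (Pos x) (set as), insert (Neg x) (set bs)#}
    (non_tautologous (resolution_consequents x as bs))"
proof -
  let ?P = "insert (Pos x) (set as)" and ?N = "insert (Neg x) (set bs)"
  let ?U = "set as \<union> set bs"
  let ?SP = "side_consequents (Pos x) as bs" and ?SN = "side_consequents (Neg x) bs as"
  have single: "non_tautologous {#?P#} = {#?P#}" "non_tautologous {#?N#} = {#?N#}"
    using assms(1,2) by (simp_all add: non_tautologous_def)
  have sub: "set as \<subseteq> lits n" "set bs \<subseteq> lits n" "Pos x \<in> lits n"
    using assms(3,4) by blast+
  note chain = sa_equiv_split_chain[OF assms(3) sub(2)] sa_equiv_split_chain[OF assms(4) sub(1)]
  have P: "sa_equiv n (3 * length bs) {#?P#} (non_tautologous ({#insert (Pos x) ?U#} + ?SP))"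
    using chain(1) unfolding single side_consequents_def Un_insert_left .
  have N: "sa_equiv n (3 * length as) {#?N#} (non_tautologous ({#insert (Neg x) ?U#} + ?SN))"
    using chain(2) unfolding single side_consequents_def Un_insert_left Un_commute[of "set bs" "set as"] .
  have U: "sa_equiv n 3 (non_tautologous {#insert (Pos x) ?U, insert (Neg x) ?U#}) (non_tautologous {#?U#})"
    using sa_equiv_sym[OF sa_equiv_split[of ?U n "Pos x"]] sub by (simp only: Un_least neg.simps)
  have "sa_equiv n 3 (non_tautologous ({#insert (Pos x) ?U, insert (Neg x) ?U#} + (?SP + ?SN)))
      (non_tautologous ({#?U#} + (?SP + ?SN)))"
    using sa_equiv_add[OF U sa_equiv_refl[of n 0 "non_tautologous (?SP + ?SN)"]]
    by (simp only: non_tautologous_add add_0_right)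
  moreover have "{#insert (Pos x) ?U, insert (Neg x) ?U#} + (?SP + ?SN)
      = ({#insert (Pos x) ?U#} + ?SP) + ({#insert (Neg x) ?U#} + ?SN)"
    by simp
  moreover have "{#?U#} + (?SP + ?SN) = resolution_consequents x as bs"
    by (simp add: resolution_consequents_def)
  ultimately have "sa_equiv n 3
      (non_tautologous ({#insert (Pos x) ?U#} + ?SP) + non_tautologous ({#insert (Neg x) ?U#} + ?SN))
      (non_tautologous (resolution_consequents x as bs))"
    by (simp only: non_tautologous_add)
  from sa_equiv_trans[OF sa_equiv_add[OF P N] this] show ?thesis
    by (simp add: add_mset_commute)
qed

text \<open>Resolution takes \<open>length as + length bs + 1\<close> splittings of cost 3 and has
  at most as many consequents; that number is at most \<open>2 * n\<close>.\<close>

lemma maxresw_step_equiv: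
  assumes "maxresw_step F G" "cnf n F" "cnf n G"
  shows "sa_equiv n (6 * n) F G \<and> size G \<le> size F + 2 * n"
  using assms
proof (cases rule: maxresw_step.cases)
  case (resolution as bs x H)
  let ?P = "insert (Pos x) (set as)" and ?N = "insert (Neg x) (set bs)"
  have cl: "\<not> tautologous ?P" "\<not> tautologous ?N" "?P \<subseteq> lits n" "?N \<subseteq> lits n"
    using assms(2) resolution(1) by (auto simp: cnf_def)
  \<comment> \<open>\<open>Suc\<close> counts the pivot literal, which is not among the side
    literals.\<close>
  have "Suc (length as) \<le> n" "Suc (length bs) \<le> n"
    using card_clause_le[OF cl(3,1)] card_clause_le[OF cl(4,2)] resolution(3-6)
    by (simp_all add: distinct_card)
  then have len: "length as + length bs + 1 \<le> 2 * n" by simp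
  have "sa_equiv n (6 * n) {#?P, ?N#} (non_tautologous (resolution_consequents x as bs))"
    using len by (intro sa_equiv_mono[OF sa_equiv_resolution[OF cl]]) simp
  from sa_equiv_add[OF sa_equiv_refl[of n 0 H] this]
  have "sa_equiv n (6 * n) F G" by (simp add: resolution(1,2))
  moreover have "size (non_tautologous (resolution_consequents x as bs)) \<le> 2 * n"
    using size_non_tautologous_le[of "resolution_consequents x as bs"] len
    by (simp add: resolution_consequents_def side_consequents_def)
  ultimately show ?thesis using resolution(1,2) by simp
next
  case (weakening H A x)
  have A: "A \<subseteq> lits n" "\<not> tautologous A"
    using assms(2) weakening(1) by (auto simp: cnf_def)
  \<comment> \<open>The rule itself does not bound \<open>x\<close>. Either \<open>Neg x\<close>
    occurs in \<open>A\<close>, or the positive half survives the filter and is a clause of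
    \<open>G\<close>.\<close>
  have x: "x \<in> {1..n}"
  proof (cases "Neg x \<in> A")
    case True
    then show ?thesis using A(1) Neg_in_lits by blast
  next
    case False
    then have "insert (Pos x) A \<in># G"
      using A(2) by (simp add: weakening(2) non_tautologous_add_mset tautologous_insert)
    then have "Pos x \<in> lits n" using assms(3) unfolding cnf_def by blast
    then show ?thesis by simp
  qed
  have "sa_equiv n 3 {#A#} (non_tautologous {#insert (Pos x) A, insert (Neg x) A#})"
    using sa_equiv_split[OF A(1), of "Pos x"] A(2) x by (simp add: non_tautologous_add_mset)
  from sa_equiv_add[OF sa_equiv_refl[of n 0 H] this]
  have "sa_equiv n 3 F G" by (simp add: weakening)
  \<comment> \<open>The existence of \<open>x\<close> forces \<open>n\<close> to be positive, so 3
    is below \<open>6 * n\<close>.\<close>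
  then have "sa_equiv n (6 * n) F G"
    using x by (elim sa_equiv_mono) auto
  moreover have "size G \<le> size F + 2 * n"
    using size_non_tautologous_le[of "{#insert (Pos x) A, insert (Neg x) A#}"] x
    by (simp add: weakening)
  ultimately show ?thesis ..
qed

lemma maxresw_refutation_equiv:
  assumes "maxresw_refutation n F \<pi>"
  shows "sa_equiv n (6 * n * refutation_size \<pi>) F (last \<pi>)
    \<and> size (last \<pi>) \<le> size F + 2 * n * refutation_size \<pi>"
proof -
  have ne: "\<pi> \<noteq> []" and hd: "hd \<pi> = F" and cnf: "\<And>H. H \<in> set \<pi> \<Longrightarrow> cnf n H"
    and step: "\<And>i. Suc i < length \<pi> \<Longrightarrow> maxresw_step (\<pi> ! i) (\<pi> ! Suc i)"
    using assms by (auto simp: maxresw_refutation_def)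
  have "sa_equiv n (6 * n * i) F (\<pi> ! i) \<and> size (\<pi> ! i) \<le> size F + 2 * n * i"
    if "i < length \<pi>" for i
    using that
  proof (induction i)
    case 0
    then show ?case using hd ne by (simp add: hd_conv_nth sa_equiv_refl)
  next
    case (Suc i)
    have IH: "sa_equiv n (6 * n * i) F (\<pi> ! i)" "size (\<pi> ! i) \<le> size F + 2 * n * i"
      using Suc by simp_all
    have next_step: "sa_equiv n (6 * n) (\<pi> ! i) (\<pi> ! Suc i)" "size (\<pi> ! Suc i) \<le> size (\<pi> ! i) + 2 * n"
      using maxresw_step_equiv[OF step[OF Suc.prems] cnf cnf] Suc.prems by simp_all
    show ?case
      using sa_equiv_trans[OF IH(1) next_step(1)] IH(2) next_step(2) by (simp add: add.commute)
  qed
  from this[of "length \<pi> - 1"] show ?thesis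
    using ne by (simp add: last_conv_nth refutation_size_def)
qed

text \<open>The removed empty clause is falsified by every assignment and is encoded as 1, which
  gives both the 1 in the violation count and the constant 1 of the representation. The algebraic
  bound adds \<open>size F\<close>, the bound on \<open>size G\<close> and the cost
  \<open>6 * n * s\<close> of \<open>s\<close> steps.\<close>

lemma subcubesums_of_refutation:
  assumes "cnf n F" "maxresw_refutation n F \<pi>"
  defines "G \<equiv> last \<pi> - {#{}#}"
  shows "subcubesums_proof n F G"
    and "combinatorial_size G \<le> size F + 2 * n * refutation_size \<pi>"
    and "algebraic_size n F G \<le> enat (2 * size F + 8 * n * refutation_size \<pi>)"
proof -
  let ?s = "refutation_size \<pi>"
  have last: "last \<pi> = add_mset {} G" and "cnf n (last \<pi>)"
    using assms(2) by (auto simp: maxresw_refutation_def G_def)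
  then have "cnf n G" by (simp add: cnf_def)
  have equiv: "sa_equiv n (6 * n * ?s) F (add_mset {} G)"
    and size: "size (add_mset {} G) \<le> size F + 2 * n * ?s"
    using maxresw_refutation_equiv[OF assms(2)] by (simp_all add: last)
  show "subcubesums_proof n F G"
    using equiv assms(1) \<open>cnf n G\<close> by (simp add: subcubesums_proof_def sa_equiv_def falsifies_def)
  show "combinatorial_size G \<le> size F + 2 * n * ?s"
    using size by (simp add: combinatorial_size_def)
  obtain r where r: "\<forall>j\<in>{1..n}. r j \<in> polys_over n"
    "(\<Sum>C\<in>#F. encode_clause C) - (1 + (\<Sum>C\<in>#G. encode_clause C)) = (\<Sum>j\<in>{1..n}. r j * axiom_poly j)"
    "(\<Sum>j\<in>{1..n}. l1_norm (r j * axiom_poly j)) \<le> 6 * n * ?s"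
    using equiv by (auto simp: sa_equiv_def)
  have "sa_representation n F G r"
    using r(1) unfolding sa_representation_def r(2)[symmetric] by simp
  then have "algebraic_size n F G \<le> enat (sa_size n F G r)"
    unfolding algebraic_size_def by (intro INF_lower) simp
  also have "\<dots> \<le> enat (2 * size F + 8 * n * ?s)"
    using r(3) size by (simp add: sa_size_def)
  finally show "algebraic_size n F G \<le> enat (2 * size F + 8 * n * ?s)" .
qed

section \<open>The translation of words\<close>

text \<open>The first argument is the symbol preceding the word. An empty clause is a 5 that is followed
  by a 5 or by the end of the word.\<close>

fun delete_empty_clause :: "nat \<Rightarrow> word \<Rightarrow> word" where
  "delete_empty_clause c [] = (if c = 5 then [] else [c])"
| "delete_empty_clause c (a # u) =
     (if c = 5 \<and> a = 5 then a # u else c # delete_empty_clause a u)"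

text \<open>The reversals select what follows the last 6; that 6 itself returns as the first
  argument of \<open>delete_empty_clause\<close>. The value \<open>[]\<close> without a 6 matches
  the machine, which then halts on a blank.\<close>

definition translate :: "word \<Rightarrow> word" where
  "translate w =
     (if 6 \<in> set w then delete_empty_clause 6 (rev (takeWhile (\<lambda>a. a \<noteq> 6) (rev w))) else [])"

lemma length_delete_empty_clause_le: "length (delete_empty_clause c u) \<le> Suc (length u)"
  by (induction u arbitrary: c) auto

text \<open>Away from 5s the function copies. The hypothesis on \<open>u\<close> ranges over all
  \<open>d\<close> because the symbol before \<open>u\<close> is whichever ends
  \<open>c # v\<close>.\<close>

lemma delete_empty_clause_append:
  assumes "c \<noteq> 5" "5 \<notin> set v" "\<And>d. d \<noteq> 5 \<Longrightarrow> delete_empty_clause d u = d # u'"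
  shows "delete_empty_clause c (v @ u) = c # v @ u'"
  using assms(1,2) by (induction v arbitrary: c) (auto simp: assms(3))

lemma delete_empty_clause_concat:
  assumes "\<And>w. w \<in> set ws \<Longrightarrow> \<exists>v. w = 5 # v \<and> 5 \<notin> set v" "[5] \<in> set ws" "c \<noteq> 5"
  shows "delete_empty_clause c (concat ws) = c # concat (remove1 [5] ws)"
  using assms
proof (induction ws arbitrary: c)
  case Nil
  then show ?case by simp
next
  case (Cons w ws)
  obtain v where v: "w = 5 # v" "5 \<notin> set v" using Cons.prems(1) by force
  show ?case
  proof (cases v)
    case Nil
    \<comment> \<open>The 5 of an empty clause is followed by the end or by the 5 of the next
      clause; it vanishes in both cases.\<close>
    have "delete_empty_clause 5 (concat ws) = concat ws"
    proof (cases ws)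
      case (Cons w' ws')
      then obtain v' where "w' = 5 # v'" using Cons.prems(1)[of w'] by auto
      then show ?thesis using Cons by simp
    qed simp
    then show ?thesis using v Nil Cons.prems(3) by simp
  next
    \<comment> \<open>Here \<open>w\<close> is not \<open>[5]\<close>, so it is copied. As its later
      symbols differ from 5, the induction hypothesis applies after it.\<close>
    case (Cons d v')
    have "delete_empty_clause d (v' @ concat ws) = d # v' @ concat (remove1 [5] ws)"
      using Cons.IH Cons.prems v Cons by (intro delete_empty_clause_append) auto
    then show ?thesis using v Cons Cons.prems by auto
  qed
qed

section \<open>Deletion on words matches deletion of an empty clause\<close>

lemma set_bits: "set (bits j) \<subseteq> {1, 2}"
proof (induction j rule: less_induct)
  case (less j)
  then show ?case
    by (subst bits.simps) auto
qed

lemma set_lit_word: "set (lit_word l) \<subseteq> {1, 2, 3, 4}"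
  using set_bits by (cases l) force+

lemma clause_wordD:
  assumes "clause_word C w"
  shows "\<exists>v. w = 5 # v \<and> set v \<subseteq> {1, 2, 3, 4}"
  using assms set_lit_word unfolding clause_word_def by fastforce

lemma clause_word_empty_iff: "clause_word {} w \<longleftrightarrow> w = [5]"
  by (auto simp: clause_word_def)

lemma clause_word_5_iff: "clause_word C [5] \<longleftrightarrow> C = {}"
proof
  assume "clause_word C [5]"
  then obtain ls where "set ls = C" "concat (map lit_word ls) = []"
    by (auto simp: clause_word_def)
  moreover have "lit_word l \<noteq> []" for l by (cases l) auto
  ultimately show "C = {}" by auto
qed (simp add: clause_word_empty_iff)

text \<open>Both removals hit the same position, since \<open>[5]\<close> is the word of the empty
  clause and of no other.\<close>

lemma list_all2_clause_word_remove1: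
  "list_all2 clause_word Cs ws \<Longrightarrow> list_all2 clause_word (remove1 {} Cs) (remove1 [5] ws)"
  by (induction rule: list_all2_induct) (auto simp: clause_word_empty_iff clause_word_5_iff)

lemma translate_append:
  assumes "6 \<notin> set u"
  shows "translate (w @ 6 # u) = delete_empty_clause 6 u"
proof -
  have "takeWhile (\<lambda>a. a \<noteq> 6) (rev u @ 6 # rev w) = rev u"
    using assms by (subst takeWhile_append2) auto
  then show ?thesis by (simp add: translate_def)
qed

text \<open>Clause words contain no 6, so the last 6 starts the word of the last multi-set.\<close>

lemma formula_word_translate:
  assumes "sequence_word \<pi> w" "\<pi> \<noteq> []" "{} \<in># last \<pi>"
  shows "formula_word (last \<pi> - {#{}#}) (translate w)"
proof -
  obtain us where us: "list_all2 formula_word \<pi> us" "w = concat us"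
    using assms(1) by (auto simp: sequence_word_def)
  have len: "length us = length \<pi>" using us(1) by (simp add: list_all2_lengthD)
  define u where "u = last us"
  have us_eq: "us = butlast us @ [u]"
    using len assms(2) by (cases us) (auto simp: u_def)
  have "formula_word (last \<pi>) u"
    using us(1) len assms(2) by (cases us) (auto simp: u_def last_conv_nth list_all2_conv_all_nth)
  then obtain Cs ws where Cs: "mset Cs = last \<pi>" "list_all2 clause_word Cs ws" "u = 6 # concat ws"
    by (auto simp: formula_word_def)
  have ws: "\<exists>v. x = 5 # v \<and> set v \<subseteq> {1, 2, 3, 4}" if "x \<in> set ws" for x
    using that Cs(2) clause_wordD by (metis in_set_conv_nth list_all2_conv_all_nth)
  have "{} \<in> set Cs" using assms(3) Cs(1) by (metis set_mset_mset)
  then have "[5] \<in> set ws"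
    using Cs(2) clause_word_empty_iff by (metis in_set_conv_nth list_all2_conv_all_nth)
  moreover have "\<exists>v. x = 5 # v \<and> 5 \<notin> set v" if "x \<in> set ws" for x
    using ws[OF that] by auto
  ultimately have "delete_empty_clause 6 (concat ws) = 6 # concat (remove1 [5] ws)"
    by (intro delete_empty_clause_concat) auto
  moreover have "6 \<notin> set (concat ws)"
    using ws by fastforce
  ultimately have "translate w = 6 # concat (remove1 [5] ws)"
    using translate_append[of "concat ws" "concat (butlast us)"] us(2) us_eq Cs(3)
    by (metis concat_append concat.simps append_Nil2)
  moreover have "mset (remove1 {} Cs) = last \<pi> - {#{}#}"
    by (simp add: Cs(1))
  ultimately show ?thesis
    using list_all2_clause_word_remove1[OF Cs(2)] unfolding formula_word_def by blast
qed

section \<open>The Turing machine\<close>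

text \<open>State 0 runs to the right end and state 1 back to the last 6, which is erased. State \<open>2 + c\<close>
  with \<open>c \<ge> 1\<close> writes the carried symbol \<open>c\<close> and picks up the scanned one, until a carried 5 is
  seen to form an empty clause and is dropped. State 2 returns to the erased cell.\<close>

fun translate_delta :: "nat \<Rightarrow> nat \<Rightarrow> nat \<times> nat \<times> move" where
  "translate_delta q a =
     (if q = 0 then (if a = 0 then (1, 0, MoveLeft) else (0, a, MoveRight))
      else if q = 1 then
        (if a = 0 then (9, 0, Stay) else if a = 6 then (8, 0, MoveRight) else (1, a, MoveLeft))
      else if q = 2 then (if a = 0 then (9, 0, MoveRight) else (2, a, MoveLeft))
      else if q = 7 \<and> (a = 5 \<or> a = 0) then (2, a, MoveLeft)
      else if a = 0 then (2, q - 2, MoveLeft)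
      else (2 + a, q - 2, MoveRight))"

text \<open>The carrying states for the symbols 1 to 6 are 3 to 8, which leaves 9 for
  halting.\<close>

definition translate_tm :: tm where
  "translate_tm = \<lparr>num_states = 9, num_symbols = 7, delta = translate_delta\<rparr>"

lemma translate_tm_simps [simp]:
  "num_states translate_tm = 9" "num_symbols translate_tm = 7"
  "delta translate_tm = translate_delta"
  by (simp_all add: translate_tm_def)

lemma wf_translate_tm: "wf_tm translate_tm"
  by (auto simp: wf_tm_def)

section \<open>Runs of the machine, one sweep at a time\<close>

definition reaches :: "nat \<Rightarrow> config \<Rightarrow> config \<Rightarrow> bool" where
  "reaches t c c' \<longleftrightarrow> (tm_step translate_tm ^^ t) c = c'"

lemma reaches_0: "reaches 0 c c"
  by (simp add: reaches_def)

lemma reaches_Suc: "reaches t (tm_step translate_tm c) c' \<Longrightarrow> reaches (Suc t) c c'"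
  by (simp add: reaches_def funpow_swap1)

lemma reaches_trans: "reaches t c c' \<Longrightarrow> reaches t' c' c'' \<Longrightarrow> reaches (t' + t) c c''"
  by (simp add: reaches_def funpow_add)

text \<open>\<open>tl\<close> and \<open>scanned\<close> describe a left move even if no cell is
  listed to the left. The extra step reads the blank at the end, which remains as an explicit
  0.\<close>

lemma scan_right:
  "0 \<notin> set u \<Longrightarrow> reaches (Suc (length u)) (0, ls, u) (1, tl (rev u @ ls), scanned (rev u @ ls) # [0])"
proof (induction u arbitrary: ls)
  case Nil
  then show ?case by (intro reaches_Suc) (simp add: reaches_0)
next
  case (Cons a u)
  from Cons.prems Cons.IH[of "a # ls"] show ?case
    by (subst length_Cons, intro reaches_Suc[of "Suc (length _)"]) simp
qed

text \<open>The 0 replacing the 6 marks the place for the return sweep, and the final state 8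
  carries that 6.\<close>

lemma scan_left_found:
  "0 \<notin> set v \<Longrightarrow> 6 \<notin> set v \<Longrightarrow>
   reaches (Suc (length v)) (1, tl (v @ 6 # ls), scanned (v @ 6 # ls) # rs) (8, 0 # ls, rev v @ rs)"
proof (induction v arbitrary: rs)
  case Nil
  then show ?case by (intro reaches_Suc) (simp add: reaches_0)
next
  case (Cons a v)
  from Cons.prems Cons.IH[of "a # rs"] show ?case
    by (subst length_Cons, intro reaches_Suc[of "Suc (length _)"]) simp
qed

lemma scan_left_not_found:
  "0 \<notin> set v \<Longrightarrow> 6 \<notin> set v \<Longrightarrow>
   reaches (Suc (length v)) (1, tl v, scanned v # rs) (9, [], 0 # rev v @ rs)"
proof (induction v arbitrary: rs)
  case Nil
  then show ?case by (intro reaches_Suc) (simp add: reaches_0)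
next
  case (Cons a v)
  from Cons.prems Cons.IH[of "a # rs"] show ?case
    by (subst length_Cons, intro reaches_Suc[of "Suc (length _)"]) simp
qed

lemma scan_return:
  "0 \<notin> set v \<Longrightarrow>
   reaches (Suc (length v)) (2, tl (v @ 0 # ls), scanned (v @ 0 # ls) # rs) (9, 0 # ls, rev v @ rs)"
proof (induction v arbitrary: rs)
  case Nil
  then show ?case by (intro reaches_Suc) (simp add: reaches_0)
next
  case (Cons a v)
  from Cons.prems Cons.IH[of "a # rs"] show ?case
    by (subst length_Cons, intro reaches_Suc[of "Suc (length _)"]) simp
qed

text \<open>The carried symbol plays the role of the first argument of
  \<open>delete_empty_clause\<close>. \<open>v\<close> holds the cells already rewritten, nearest
  first, and \<open>rs\<close> the rest; where they meet depends on where an empty clause is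
  found.\<close>

lemma scan_carry:
  assumes "set u \<subseteq> {1..6}" "c \<in> {1..6}"
  shows "\<exists>t v rs. t \<le> Suc (length u) \<and> 0 \<notin> set v \<and>
    rev v @ takeWhile (\<lambda>a. a \<noteq> 0) rs = delete_empty_clause c u \<and>
    reaches t (2 + c, ls, u @ [0]) (2, tl (v @ ls), scanned (v @ ls) # rs)"
  using assms
proof (induction u arbitrary: c ls)
  case Nil
  have "reaches (Suc 0) (2 + c, ls, [] @ [0])
      (2, tl ([] @ ls), scanned ([] @ ls) # [if c = 5 then 0 else c])"
    using Nil.prems by (intro reaches_Suc) (auto simp: reaches_0)
  then show ?case using Nil.prems
    by (intro exI[of _ "Suc 0"] exI[of _ "[]"] exI[of _ "[if c = 5 then 0 else c]"]) simp
next
  case (Cons a u)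
  have a: "a \<in> {1..6}" "set u \<subseteq> {1..6}" using Cons.prems(1) by auto
  show ?case
  proof (cases "c = 5 \<and> a = 5")
    case True
    \<comment> \<open>The carried 5 is dropped, so the gap is closed and all cells from here on stay
      as they are.\<close>
    have "reaches (Suc 0) (2 + c, ls, (a # u) @ [0])
        (2, tl ([] @ ls), scanned ([] @ ls) # a # u @ [0])"
      using True by (intro reaches_Suc) (simp add: reaches_0)
    moreover have "takeWhile (\<lambda>a. a \<noteq> 0) (a # u @ [0]) = a # u"
      using a by (subst append_Cons[symmetric], subst takeWhile_append2) auto
    ultimately show ?thesis using True
      by (intro exI[of _ "Suc 0"] exI[of _ "[]"] exI[of _ "a # u @ [0]"]) simp
  next
    case False
    obtain t v rs where IH: "t \<le> Suc (length u)" "0 \<notin> set v"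
      "rev v @ takeWhile (\<lambda>a. a \<noteq> 0) rs = delete_empty_clause a u"
      "reaches t (2 + a, c # ls, u @ [0]) (2, tl (v @ c # ls), scanned (v @ c # ls) # rs)"
      using Cons.IH[OF a(2,1), of "c # ls"] by blast
    have "tm_step translate_tm (2 + c, ls, (a # u) @ [0]) = (2 + a, c # ls, u @ [0])"
      using False a(1) Cons.prems(2) by auto
    then have "reaches (Suc t) (2 + c, ls, (a # u) @ [0])
        (2, tl ((v @ [c]) @ ls), scanned ((v @ [c]) @ ls) # rs)"
      using IH(4) by (intro reaches_Suc) simp
    then show ?thesis using IH(1-3) False Cons.prems(2)
      by (intro exI[of _ "Suc t"] exI[of _ "v @ [c]"] exI[of _ rs]) auto
  qed
qed

text \<open>There are at most four sweeps: right, left, carrying and return. Each takes at most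
  \<open>length w + 1\<close> steps.\<close>

lemma tm_outputs_translate:
  assumes "set w \<subseteq> {1..6}"
  shows "\<exists>t \<le> 4 * length w + 6. tm_outputs translate_tm w t (translate w)"
proof -
  have nz: "0 \<notin> set w" using assms by auto
  have right: "reaches (Suc (length w)) (0, [], w) (1, tl (rev w), scanned (rev w) # [0])"
    using scan_right[OF nz, of "[]"] by simp
  have "\<exists>t ls rs. t \<le> 4 * length w + 6 \<and> reaches t (0, [], w) (9, ls, rs) \<and>
      translate w = takeWhile (\<lambda>a. a \<noteq> 0) rs"
  proof (cases "6 \<in> set w")
    case False
    then have "reaches (Suc (length (rev w))) (1, tl (rev w), scanned (rev w) # [0])
        (9, [], 0 # rev (rev w) @ [0])"
      using nz by (intro scan_left_not_found) auto
    from reaches_trans[OF right this] False show ?thesis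
      by (intro exI[of _ "Suc (length (rev w)) + Suc (length w)"] exI[of _ "[]"] exI[of _ "0 # w @ [0]"])
        (simp add: translate_def)
  next
    case True
    then obtain u v where w: "w = v @ 6 # u" "6 \<notin> set u"
      by (metis split_list_last)
    have "reaches (Suc (length (rev u))) (1, tl (rev w), scanned (rev w) # [0]) (8, 0 # rev v, rev (rev u) @ [0])"
      using scan_left_found[of "rev u" "rev v" "[0]"] w nz by simp
    \<comment> \<open>Writing 8 as \<open>2 + 6\<close> exposes the carried symbol for
      \<open>scan_carry\<close>.\<close>
    then have left: "reaches (Suc (length u)) (1, tl (rev w), scanned (rev w) # [0]) (2 + 6, 0 # rev v, u @ [0])"
      by simp
    obtain t x rs where t: "t \<le> Suc (length u)" "0 \<notin> set x"
      "rev x @ takeWhile (\<lambda>a. a \<noteq> 0) rs = delete_empty_clause 6 u"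
      "reaches t (2 + 6, 0 # rev v, u @ [0]) (2, tl (x @ 0 # rev v), scanned (x @ 0 # rev v) # rs)"
      using scan_carry[of u 6 "0 # rev v"] assms w(1) by auto
    have "length x \<le> Suc (length u)"
      using arg_cong[OF t(3), of length] length_delete_empty_clause_le[of 6 u] by simp
    then have "Suc (length x) + t + (Suc (length u) + Suc (length w)) \<le> 4 * length w + 6"
      using t(1) w(1) by simp
    moreover have "reaches (Suc (length x) + t + (Suc (length u) + Suc (length w)))
        (0, [], w) (9, 0 # rev v, rev x @ rs)"
      by (intro reaches_trans[OF reaches_trans[OF right left]] reaches_trans[OF t(4)] scan_return t(2))
    moreover have "takeWhile (\<lambda>a. a \<noteq> 0) (rev x @ rs) = delete_empty_clause 6 u"
      using t(2,3) by (subst takeWhile_append2) (auto intro!: gr0I)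
    then have "translate w = takeWhile (\<lambda>a. a \<noteq> 0) (rev x @ rs)"
      using w(1) translate_append[OF w(2), of v] by simp
    ultimately show ?thesis by blast
  qed
  then show ?thesis by (auto simp: tm_outputs_def reaches_def)
qed

lemma poly_time_translate: "poly_time alphabet_size translate"
proof -
  have "\<exists>t \<le> poly [:6, 4:] (length w). tm_outputs translate_tm w t (translate w)"
    if "set w \<subseteq> {1..6}" for w
    using tm_outputs_translate[OF that] by (simp add: mult.commute add.commute)
  then show ?thesis
    unfolding poly_time_def using wf_translate_tm by (intro exI[of _ translate_tm] exI[of _ "[:6, 4:]"]) auto
qed

theorem proposition2p1:
  "\<exists>(f :: word \<Rightarrow> word) (K :: nat).
     p_simulation f SubCubeSums MaxResW \<and>
     (\<forall>n m s F \<pi> w.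
        cnf n F \<and> unsatisfiable F \<and> size F = m \<and>
        maxresw_refutation n F \<pi> \<and> refutation_size \<pi> = s \<and> sequence_word \<pi> w \<longrightarrow>
        (\<exists>G. subcubesums_proof n F G \<and> formula_word G (f w) \<and>
             combinatorial_size G \<le> K * (m + n * s) \<and>
             algebraic_size n F G \<le> enat (K * (m + n * s))))"
proof -
  \<comment> \<open>The constant 8 is the larger coefficient in the algebraic bound and also covers
    the combinatorial one.\<close>
  have main: "\<exists>G. subcubesums_proof n F G \<and> formula_word G (translate w) \<and>
      combinatorial_size G \<le> 8 * (size F + n * refutation_size \<pi>) \<and>
      algebraic_size n F G \<le> enat (8 * (size F + n * refutation_size \<pi>))"
    if "cnf n F" "maxresw_refutation n F \<pi>" "sequence_word \<pi> w" for n F \<pi> w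
  proof (intro exI conjI)
    note G = subcubesums_of_refutation[OF that(1,2)]
    show "subcubesums_proof n F (last \<pi> - {#{}#})" by (rule G)
    show "formula_word (last \<pi> - {#{}#}) (translate w)"
      using that by (intro formula_word_translate) (auto simp: maxresw_refutation_def)
    show "combinatorial_size (last \<pi> - {#{}#}) \<le> 8 * (size F + n * refutation_size \<pi>)"
      by (rule le_trans[OF G(2)]) simp
    show "algebraic_size n F (last \<pi> - {#{}#}) \<le> enat (8 * (size F + n * refutation_size \<pi>))"
      by (rule order_trans[OF G(3)]) simp
  qed
  have "p_simulation translate SubCubeSums MaxResW"
    using main poly_time_translate unfolding p_simulation_def SubCubeSums_def MaxResW_def by blast
  with main show ?thesis by blast
qed

end
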